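(* Let $p,q\ge1$ and let $\hat a(z)=z^p+a_1z^{p-1}+\cdots+a_p$, $\hat c(z)=z^q+c_1z^{q-1}+\cdots+c_q$ be real polynomials all of whose zeros lie inside the open unit disc. Let $\varepsilon$ be a white noise sequence and let $\xi=\dot\varepsilon^\top$ be the $\mathbb{R}^{p+q}$-valued process defined in the context. Then $\xi$ is the state process of the stable system $$\xi_{t+1}=F\xi_t+B\varepsilon_t,\qquad F=\begin{pmatrix}J-e_pa^\top&0\\0&J-e_qc^\top\end{pmatrix},\qquad B=\begin{pmatrix}e_p\\-e_q\end{pmatrix}.$$ This system is controllable if and only if $\hat a$ and $\hat c$ have no common zeros.
   Context: $a(z)=z^p\hat a(z^{-1})=1+a_1z+\cdots+a_pz^p$ and $c(z)=z^q\hat c(z^{-1})=1+c_1z+\cdots+c_qz^q$; the same letters denote the column vectors $a=(a_1,\dots,a_p)^\top$, $c=(c_1,\dots,c_q)^\top$. $e_k$ is the first standard basis vector of $\mathbb{R}^k$; $J$ denotes the shift matrix of the appropriate size, $J_{ij}=1$ if $i=j+1$ and $0$ otherwise. The $a_j$, $c_l$ are the parameters of the stationary, causal and invertible ARMA$(p,q)$ process $y$ with $a(L)y=c(L)\varepsilon$, $L$ the lag operator. The derivatives of $\varepsilon_t$ with respect to the parameters are $\varepsilon^{a_j}_t=\frac1{a(L)}\varepsilon_{t-j}$ ($1\le j\le p$) and $\varepsilon^{c_l}_t=-\frac1{c(L)}\varepsilon_{t-l}$ ($1\le l\le q$), where $1/a(L)$, $1/c(L)$ are the power series expansions in $L$;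 $\dot\varepsilon_t$ is the row vector $(\varepsilon^{a_1}_t,\dots,\varepsilon^{a_p}_t,\varepsilon^{c_1}_t,\dots,\varepsilon^{c_q}_t)$. Equivalently, $\xi$ has transfer function from $\varepsilon$ (replace $L$ by $z^{-1}$) $$\tau(z)=\begin{pmatrix}\frac1{\hat a(z)}u_p^*(z)\\-\frac1{\hat c(z)}u_q^*(z)\end{pmatrix},\qquad u_k^*(z)=(z^{k-1},\dots,z,1)^\top,$$ and being the state process of the system means $(zI-F)^{-1}B=\tau(z)$. The system is stable if all eigenvalues of $F$ lie in the open unit disc; controllability has the usual meaning (full rank of the controllability matrix of $(F,B)$). *)

theory Defs
  imports
    "HOL-Probability.Probability"
    "HOL-Computational_Algebra.Formal_Power_Series"
    "HOL-Computational_Algebra.Polynomial_FPS"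
    "Jordan_Normal_Form.Char_Poly"
    "Jordan_Normal_Form.DL_Rank"
begin

unbundle no vec_syntax

text \<open>
  A coefficient vector \<open>a = (a\<^sub>1, \<dots>, a\<^sub>p)\<close> is a vector of dimension \<open>p\<close> indexed from 0, so
  the entry with index \<open>j\<close> is \<open>a\<^sub>j\<^sub>+\<^sub>1\<close>.
\<close>

text \<open>\<open>z\<^sup>p + a\<^sub>1 z\<^sup>p\<^sup>-\<^sup>1 + \<dots> + a\<^sub>p\<close>\<close>

definition hat_poly :: "real Matrix.vec \<Rightarrow> real poly" where
  "hat_poly a = monom 1 (dim_vec a)
     + (\<Sum>j<dim_vec a. monom (vec_index a j) (dim_vec a - Suc j))"

text \<open>\<open>1 + a\<^sub>1 z + \<dots> + a\<^sub>p z\<^sup>p\<close>\<close>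

definition lag_poly :: "real Matrix.vec \<Rightarrow> real poly" where
  "lag_poly a = 1 + (\<Sum>j<dim_vec a. monom (vec_index a j) (Suc j))"

definition complex_zeros :: "real poly \<Rightarrow> complex set" where
  "complex_zeros f = {z. poly (map_poly complex_of_real f) z = 0}"

definition white_noise :: "'w measure \<Rightarrow> (int \<Rightarrow> 'w \<Rightarrow> real) \<Rightarrow> bool" where
  "white_noise M \<epsilon> \<longleftrightarrow> prob_space M
     \<and> (\<forall>t. \<epsilon> t \<in> borel_measurable M)
     \<and> (\<forall>t. integrable M (\<lambda>\<omega>. (\<epsilon> t \<omega>)\<^sup>2))
     \<and> (\<forall>t. (\<integral>\<omega>. \<epsilon> t \<omega> \<partial>M) = 0)
     \<and> (\<exists>\<sigma>2. \<forall>t. (\<integral>\<omega>. (\<epsilon> t \<omega>)\<^sup>2 \<partial>M) = \<sigma>2)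
     \<and> (\<forall>s t. s \<noteq> t \<longrightarrow> (\<integral>\<omega>. \<epsilon> s \<omega> * \<epsilon> t \<omega> \<partial>M) = 0)"

text \<open>
  The power series \<open>f(L)\<close> in the lag operator applied to a process \<open>x\<close>.  It is defined pathwise;
  the sum is meaningful (almost surely and in mean square) when \<open>filter_converges\<close> holds.
\<close>

definition lag_filter :: "real fps \<Rightarrow> (int \<Rightarrow> 'w \<Rightarrow> real) \<Rightarrow> int \<Rightarrow> 'w \<Rightarrow> real" where
  "lag_filter f x t \<omega> = (\<Sum>k. fps_nth f k * x (t - int k) \<omega>)"

definition filter_converges ::
  "'w measure \<Rightarrow> real fps \<Rightarrow> (int \<Rightarrow> 'w \<Rightarrow> real) \<Rightarrow> int \<Rightarrow> bool" where
  "filter_converges M f x t \<longleftrightarrow>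
     (AE \<omega> in M. summable (\<lambda>k. \<bar>fps_nth f k * x (t - int k) \<omega>\<bar>))
     \<and> (\<lambda>n. \<integral>\<^sup>+\<omega>. ennreal (((\<Sum>k<n. fps_nth f k * x (t - int k) \<omega>) - lag_filter f x t \<omega>)\<^sup>2) \<partial>M)
         \<longlonglongrightarrow> 0"

text \<open>The power series expansion of \<open>1 / a(L)\<close>\<close>

definition inv_lag :: "real Matrix.vec \<Rightarrow> real fps" where
  "inv_lag a = inverse (fps_of_poly (lag_poly a))"

text \<open>
  The transposed derivative vector \<open>\<xi>\<^sub>t\<close>: the entries \<open>(1/a(L)) \<epsilon>\<^sub>t\<^sub>-\<^sub>j\<close> for \<open>j = 1, \<dots>, p\<close>
  followed by \<open>-(1/c(L)) \<epsilon>\<^sub>t\<^sub>-\<^sub>l\<close> for \<open>l = 1, \<dots>, q\<close>.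
\<close>

definition xi_process ::
  "real Matrix.vec \<Rightarrow> real Matrix.vec \<Rightarrow> (int \<Rightarrow> 'w \<Rightarrow> real) \<Rightarrow> int \<Rightarrow> 'w \<Rightarrow> real Matrix.vec" where
  "xi_process a c \<epsilon> t \<omega> =
     Matrix.vec (dim_vec a) (\<lambda>i. lag_filter (inv_lag a) \<epsilon> (t - int (Suc i)) \<omega>)
     @\<^sub>v Matrix.vec (dim_vec c) (\<lambda>i. - lag_filter (inv_lag c) \<epsilon> (t - int (Suc i)) \<omega>)"

definition u_star :: "nat \<Rightarrow> complex \<Rightarrow> complex Matrix.vec" where
  "u_star k z = Matrix.vec k (\<lambda>i. z ^ (k - 1 - i))"

definition tau :: "real Matrix.vec \<Rightarrow> real Matrix.vec \<Rightarrow> complex \<Rightarrow> complex Matrix.vec" where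
  "tau a c z =
     (1 / poly (map_poly complex_of_real (hat_poly a)) z) \<cdot>\<^sub>v u_star (dim_vec a) z
     @\<^sub>v (- (1 / poly (map_poly complex_of_real (hat_poly c)) z)) \<cdot>\<^sub>v u_star (dim_vec c) z"

definition shift_mat :: "nat \<Rightarrow> real Matrix.mat" where
  "shift_mat k = Matrix.mat k k (\<lambda>(i, j). if i = j + 1 then 1 else 0)"

text \<open>\<open>J - e a\<^sup>T\<close>, with \<open>e\<close> the first standard basis vector\<close>

definition companion_block :: "real Matrix.vec \<Rightarrow> real Matrix.mat" where
  "companion_block a =
     shift_mat (dim_vec a) - mat_of_cols (dim_vec a) [unit_vec (dim_vec a) 0] * mat_of_row a"

definition F_mat :: "real Matrix.vec \<Rightarrow> real Matrix.vec \<Rightarrow> real Matrix.mat" where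
  "F_mat a c = four_block_mat
     (companion_block a) (0\<^sub>m (dim_vec a) (dim_vec c))
     (0\<^sub>m (dim_vec c) (dim_vec a)) (companion_block c)"

definition B_vec :: "nat \<Rightarrow> nat \<Rightarrow> real Matrix.vec" where
  "B_vec p q = unit_vec p 0 @\<^sub>v - unit_vec q 0"

definition stable_mat :: "real Matrix.mat \<Rightarrow> bool" where
  "stable_mat F \<longleftrightarrow> (\<forall>z. eigenvalue (map_mat complex_of_real F) z \<longrightarrow> cmod z < 1)"

text \<open>Full rank of \<open>(B, F B, \<dots>, F\<^sup>n\<^sup>-\<^sup>1 B)\<close>, where \<open>n\<close> is the state dimension\<close>

definition controllability_mat :: "real Matrix.mat \<Rightarrow> real Matrix.vec \<Rightarrow> real Matrix.mat" where
  "controllability_mat F B =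
     mat_of_cols (dim_row F) (map (\<lambda>k. (F ^\<^sub>m k) *\<^sub>v B) [0..<dim_row F])"

definition controllable :: "real Matrix.mat \<Rightarrow> real Matrix.vec \<Rightarrow> bool" where
  "controllable F B \<longleftrightarrow> vec_space.rank (dim_row F) (controllability_mat F B) = dim_row F"

text \<open>
  The identity \<open>(z I - F)\<^sup>-\<^sup>1 B = T(z)\<close> of rational functions, read pointwise on a set \<open>S\<close>
  of complex numbers; it includes that \<open>z I - F\<close> is invertible there.
\<close>

definition has_transfer_function_on ::
  "real Matrix.mat \<Rightarrow> real Matrix.vec \<Rightarrow> (complex \<Rightarrow> complex Matrix.vec) \<Rightarrow> complex set \<Rightarrow> bool" where
  "has_transfer_function_on F B T S \<longleftrightarrow>
     (\<forall>z\<in>S. \<exists>R \<in> carrier_mat (dim_row F) (dim_row F).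
        inverts_mat R (z \<cdot>\<^sub>m 1\<^sub>m (dim_row F) - map_mat complex_of_real F)
        \<and> inverts_mat (z \<cdot>\<^sub>m 1\<^sub>m (dim_row F) - map_mat complex_of_real F) R
        \<and> R *\<^sub>v map_vec complex_of_real B = T z)"

end

theory Submission
  imports Defs
    "HOL-Complex_Analysis.Cauchy_Integral_Formula"
    "HOL-Computational_Algebra.Field_as_Ring"
begin

text \<open>
  Since \<open>a(z) = z\<^sup>p hat a(1/z)\<close>, the zeros of the lag polynomials lie outside the closed unit disc,
  so the expansions of \<open>1/a(L)\<close> and \<open>1/c(L)\<close> have radius of convergence greater than 1 and
  absolutely summable coefficients \<open>f\<^sub>k\<close>.  The weighted Cauchy-Schwarz inequality
  \<open>(\<Sum>f\<^sub>k x\<^sub>k)\<^sup>2 \<le> (\<Sum>\<bar>f\<^sub>k\<bar>) (\<Sum>\<bar>f\<^sub>k\<bar> x\<^sub>k\<^sup>2)\<close>, applied to the tails, gives convergence of the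
  filters in mean square, and the recurrence for the coefficients gives the state equation.

  For controllability, the entries of \<open>F\<^sup>k B\<close> are the coefficients of \<open>L\<^sup>k\<close> in \<open>L\<^sup>i/a(L)\<close> and
  \<open>-L\<^sup>i/c(L)\<close>.  Hence a row vector with entries \<open>(u, w)\<close> annihilates \<open>F\<^sup>k B\<close> for all \<open>k < p + q\<close>
  iff \<open>U/a - W/c\<close> vanishes to order \<open>p + q\<close>, where \<open>U\<close> and \<open>W\<close> have coefficients \<open>u\<close>, \<open>w\<close>;
  comparing degrees, iff \<open>U c = W a\<close>.  If the lag polynomials are coprime, \<open>(U, W)\<close> is a common
  multiple \<open>S\<close> of \<open>(a, c)\<close>, and \<open>S \<noteq> 0\<close> would force \<open>deg a < p\<close> and \<open>deg c < q\<close>, that is, 0 would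
  be a common zero of \<open>hat a\<close> and \<open>hat c\<close>.
\<close>

unbundle no vec_syntax and no inner_syntax

subsection \<open>Lag polynomials and their inverses\<close>

interpretation of_real_poly: map_poly_inj_idom_hom complex_of_real ..

lemma poly_hat_poly:
  "poly (map_poly complex_of_real (hat_poly a)) z =
     z ^ dim_vec a + (\<Sum>j<dim_vec a. complex_of_real (a $ j) * z ^ (dim_vec a - Suc j))"
  by (simp add: hat_poly_def of_real_poly.hom_add of_real_poly.hom_sum poly_sum poly_monom)

lemma poly_lag_poly:
  "poly (map_poly complex_of_real (lag_poly a)) z =
     1 + (\<Sum>j<dim_vec a. complex_of_real (a $ j) * z ^ Suc j)"
  by (simp add: lag_poly_def of_real_poly.hom_add of_real_poly.hom_sum poly_sum poly_monom)

text \<open>The two polynomials are reversals of each other, z^p hat a(1/z) = a(z) for z \<noteq> 0,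
  and the constant term 1 of the lag polynomial excludes z = 0.\<close>

lemma lag_poly_zero_imp_hat_poly_zero:
  assumes "poly (map_poly complex_of_real (lag_poly a)) z = 0"
  shows "z \<noteq> 0" and "inverse z \<in> complex_zeros (hat_poly a)"
proof -
  show z: "z \<noteq> 0"
    using assms by (auto simp: poly_lag_poly)
  have "z ^ dim_vec a * poly (map_poly complex_of_real (hat_poly a)) (inverse z) =
      poly (map_poly complex_of_real (lag_poly a)) z"
  proof -
    have terms: "z ^ dim_vec a * (complex_of_real (a $ j) * inverse z ^ (dim_vec a - Suc j)) =
        complex_of_real (a $ j) * z ^ Suc j" if "j < dim_vec a" for j
    proof -
      have "z ^ dim_vec a = z ^ Suc j * z ^ (dim_vec a - Suc j)"
        using power_add[of z "Suc j" "dim_vec a - Suc j"] that by (simp del: power_Suc)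
      then show ?thesis
        using z by (simp add: power_inverse del: power_Suc)
    qed
    have top: "z ^ dim_vec a * inverse z ^ dim_vec a = 1"
      using z by (simp flip: power_mult_distrib)
    show ?thesis
      unfolding poly_hat_poly poly_lag_poly distrib_left sum_distrib_left
      by (intro arg_cong2[where f = "(+)"] sum.cong refl top terms) simp
  qed
  then show "inverse z \<in> complex_zeros (hat_poly a)"
    using assms z by (simp add: complex_zeros_def)
qed

lemma coeff_lag_poly:
  "coeff (lag_poly a) k = (if k = 0 then 1 else if k \<le> dim_vec a then a $ (k - 1) else 0)"
proof (cases k)
  case 0
  then show ?thesis by (simp add: lag_poly_def coeff_sum)
next
  case (Suc m)
  have "(\<Sum>j<dim_vec a. coeff (monom (a $ j) (Suc j)) (Suc m)) = (\<Sum>j<dim_vec a. if j = m then a $ j else 0)"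
    by (intro sum.cong) auto
  then show ?thesis by (simp add: Suc lag_poly_def coeff_sum)
qed

lemma degree_lag_poly_le: "degree (lag_poly a) \<le> dim_vec a"
  by (rule degree_le) (auto simp: coeff_lag_poly)

lemma lag_poly_times_inv_lag: "fps_of_poly (lag_poly a) * inv_lag a = 1"
  unfolding inv_lag_def by (rule inverse_mult_eq_1') (simp add: coeff_lag_poly)

lemma inv_lag_0: "fps_nth (inv_lag a) 0 = 1"
  by (simp add: inv_lag_def coeff_lag_poly)

text \<open>\<open>lag_coeff a k i\<close> is the coefficient of \<open>L\<^sup>k\<close> in \<open>L\<^sup>i / a(L)\<close>.\<close>

definition lag_coeff :: "real Matrix.vec \<Rightarrow> nat \<Rightarrow> nat \<Rightarrow> real" where
  "lag_coeff a k i = (if i \<le> k then fps_nth (inv_lag a) (k - i) else 0)"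

text \<open>Compare coefficients of L^(k+1) in a(L) (1/a(L)) = 1. This recurrence drives both the
  state equation and the powers of F.\<close>

lemma inv_lag_Suc:
  "fps_nth (inv_lag a) (Suc k) = - (\<Sum>j<dim_vec a. a $ j * lag_coeff a k j)"
proof -
  have "0 = fps_nth (fps_of_poly (lag_poly a) * inv_lag a) (Suc k)"
    by (simp add: lag_poly_times_inv_lag)
  also have "\<dots> = (\<Sum>i\<le>Suc k. coeff (lag_poly a) i * fps_nth (inv_lag a) (Suc k - i))"
    by (simp add: fps_mult_nth atMost_atLeast0)
  also have "\<dots> = fps_nth (inv_lag a) (Suc k)
      + (\<Sum>i\<le>k. coeff (lag_poly a) (Suc i) * fps_nth (inv_lag a) (k - i))"
    by (subst sum.atMost_Suc_shift) (simp add: coeff_lag_poly)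
  \<comment> \<open>Both index ranges can be enlarged to their union: coefficients of a(L) vanish
    beyond its dimension, and \<open>lag_coeff a k j\<close> is 0 for j > k.\<close>
  also have "(\<Sum>i\<le>k. coeff (lag_poly a) (Suc i) * fps_nth (inv_lag a) (k - i))
      = (\<Sum>j\<in>{..<dim_vec a} \<union> {..k}. (if j < dim_vec a then a $ j else 0) * lag_coeff a k j)"
    by (rule sum.mono_neutral_cong_left) (auto simp: coeff_lag_poly lag_coeff_def)
  also have "\<dots> = (\<Sum>j<dim_vec a. a $ j * lag_coeff a k j)"
    by (rule sum.mono_neutral_cong_right) auto
  finally show ?thesis by simp
qed

lemma summable_inv_lag:
  assumes "\<forall>z \<in> complex_zeros (hat_poly a). cmod z < 1"
  shows "summable (\<lambda>k. \<bar>fps_nth (inv_lag a) k\<bar>)"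
proof -
  define f where "f = map_poly complex_of_real (lag_poly a)"
  \<comment> \<open>The default 2 keeps the set nonempty when there are no zeros; it only has to
    exceed 1.\<close>
  define R where "R = Min (insert 2 (cmod ` {z. poly f z = 0}))"
  have f0: "coeff f 0 = 1"
    by (simp add: f_def coeff_lag_poly)
  then have "f \<noteq> 0" by auto
  then have fin: "finite {z. poly f z = 0}"
    by (rule poly_roots_finite)
  have outside: "cmod z > 1" if "poly f z = 0" for z
  proof -
    note z = lag_poly_zero_imp_hat_poly_zero[OF that[unfolded f_def]]
    then have "cmod (inverse z) < 1" using assms by blast
    then show ?thesis
      using z(1) by (simp add: norm_inverse inverse_less_1_iff)
  qed
  have "R > 1"
    unfolding R_def using fin outside by (subst Min_gr_iff) auto
  \<comment> \<open>The reciprocal of a polynomial without zeros in the disc of radius R is analytic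
    there, so its expansion converges up to R > 1.\<close>
  have "eval_fps (fps_of_poly f) z \<noteq> 0" if "ereal (cmod z) < ereal R" for z
    using that fin unfolding R_def by (auto simp: eval_fps_of_poly)
  then have "min (ereal R) (fps_conv_radius (fps_of_poly f)) \<le> fps_conv_radius (inverse (fps_of_poly f))"
    by (rule fps_conv_radius_inverse)
  then have "ereal (norm (1::complex)) < fps_conv_radius (inverse (fps_of_poly f))"
    using \<open>R > 1\<close> by (metis fps_conv_radius_fps_of_poly min_PInf2 ereal_less_eq(3) less_ereal.simps(1) norm_one order_less_le_trans)
  then have sm: "summable (\<lambda>k. norm (fps_nth (inverse (fps_of_poly f)) k * 1 ^ k))"
    by (intro abs_summable_in_conv_radius) (simp add: fps_conv_radius_def)
  \<comment> \<open>The complex image of the real expansion also inverts f, so by uniqueness the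
    summability carries over to the real coefficients.\<close>
  have "inverse (fps_of_poly f) = Abs_fps (\<lambda>k. complex_of_real (fps_nth (inv_lag a) k))"
  proof (rule fps_inverse_unique)
    show "fps_of_poly f * Abs_fps (\<lambda>k. complex_of_real (fps_nth (inv_lag a) k)) = 1"
    proof (rule fps_ext)
      fix n
      have "fps_nth (fps_of_poly f * Abs_fps (\<lambda>k. complex_of_real (fps_nth (inv_lag a) k))) n
          = complex_of_real (fps_nth (fps_of_poly (lag_poly a) * inv_lag a) n)"
        by (simp add: fps_mult_nth f_def)
      then show "fps_nth (fps_of_poly f * Abs_fps (\<lambda>k. complex_of_real (fps_nth (inv_lag a) k))) n
          = fps_nth 1 n"
        by (simp add: lag_poly_times_inv_lag)
    qed
  qed
  with sm show ?thesis by simp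
qed

subsection \<open>Filters of white noise\<close>

text \<open>Finite Cauchy-Schwarz with f x split as (sgn f sqrt \<bar>f\<bar>) (sqrt \<bar>f\<bar>
  x), followed by passage to the limit.\<close>

lemma suminf_Cauchy_Schwarz_weighted:
  fixes f x :: "nat \<Rightarrow> real"
  assumes f: "summable (\<lambda>k. \<bar>f k\<bar>)" and fx2: "summable (\<lambda>k. \<bar>f k\<bar> * (x k)\<^sup>2)"
    and fx: "summable (\<lambda>k. f k * x k)"
  shows "(\<Sum>k. f k * x k)\<^sup>2 \<le> (\<Sum>k. \<bar>f k\<bar>) * (\<Sum>k. \<bar>f k\<bar> * (x k)\<^sup>2)"
proof (rule LIMSEQ_le)
  show "(\<lambda>n. (\<Sum>k<n. f k * x k)\<^sup>2) \<longlonglongrightarrow> (\<Sum>k. f k * x k)\<^sup>2"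
    by (intro tendsto_power summable_LIMSEQ fx)
  show "(\<lambda>n. (\<Sum>k<n. \<bar>f k\<bar>) * (\<Sum>k<n. \<bar>f k\<bar> * (x k)\<^sup>2))
      \<longlonglongrightarrow> (\<Sum>k. \<bar>f k\<bar>) * (\<Sum>k. \<bar>f k\<bar> * (x k)\<^sup>2)"
    by (intro tendsto_mult summable_LIMSEQ f fx2)
  have "(\<Sum>k<n. f k * x k)\<^sup>2 \<le> (\<Sum>k<n. \<bar>f k\<bar>) * (\<Sum>k<n. \<bar>f k\<bar> * (x k)\<^sup>2)" for n
  proof -
    let ?u = "\<lambda>k. sgn (f k) * sqrt \<bar>f k\<bar>" and ?v = "\<lambda>k. sqrt \<bar>f k\<bar> * x k"
    have uv: "?u k * ?v k = f k * x k" for k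
      by (simp add: mult.assoc[symmetric]) (simp add: mult.assoc sgn_mult_abs)
    have u2: "(?u k)\<^sup>2 = \<bar>f k\<bar>" for k
      by (simp add: power_mult_distrib sgn_if)
    have v2: "(?v k)\<^sup>2 = \<bar>f k\<bar> * (x k)\<^sup>2" for k
      by (simp add: power_mult_distrib)
    show ?thesis
      using Cauchy_Schwarz_ineq_sum[of ?u ?v "{..<n}"] unfolding uv u2 v2 .
  qed
  then show "\<exists>N. \<forall>n\<ge>N. (\<Sum>k<n. f k * x k)\<^sup>2 \<le> (\<Sum>k<n. \<bar>f k\<bar>) * (\<Sum>k<n. \<bar>f k\<bar> * (x k)\<^sup>2)"
    by blast
qed

text \<open>Monotone convergence exchanges sum and integral. The finite value gives almost sure
  convergence of the weighted squares; applied to shifted sequences it bounds the tails.\<close>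

lemma nn_integral_weighted_squares:
  fixes x :: "nat \<Rightarrow> 'w \<Rightarrow> real" and f :: "nat \<Rightarrow> real"
  assumes [measurable]: "\<And>k. x k \<in> borel_measurable M"
    and int: "\<And>k. integrable M (\<lambda>\<omega>. (x k \<omega>)\<^sup>2)"
    and var: "\<And>k. (\<integral>\<omega>. (x k \<omega>)\<^sup>2 \<partial>M) = \<sigma>2"
    and f: "summable (\<lambda>k. \<bar>f k\<bar>)"
  shows "(\<integral>\<^sup>+\<omega>. (\<Sum>k. ennreal (\<bar>f k\<bar> * (x k \<omega>)\<^sup>2)) \<partial>M) = ennreal ((\<Sum>k. \<bar>f k\<bar>) * \<sigma>2)"
proof -
  have "\<sigma>2 \<ge> 0"
    unfolding var[of 0, symmetric] by (rule Bochner_Integration.integral_nonneg) simp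
  have "(\<integral>\<^sup>+\<omega>. ennreal (\<bar>f k\<bar> * (x k \<omega>)\<^sup>2) \<partial>M) = ennreal (\<bar>f k\<bar> * \<sigma>2)" for k
    by (subst nn_integral_eq_integral) (auto simp: int var)
  then have "(\<integral>\<^sup>+\<omega>. (\<Sum>k. ennreal (\<bar>f k\<bar> * (x k \<omega>)\<^sup>2)) \<partial>M) = (\<Sum>k. ennreal (\<bar>f k\<bar> * \<sigma>2))"
    by (subst nn_integral_suminf) auto
  also have "\<dots> = ennreal (\<Sum>k. \<bar>f k\<bar> * \<sigma>2)"
    using f \<open>\<sigma>2 \<ge> 0\<close> by (intro suminf_ennreal2) (auto intro: summable_mult2)
  also have "(\<Sum>k. \<bar>f k\<bar> * \<sigma>2) = (\<Sum>k. \<bar>f k\<bar>) * \<sigma>2"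
    using f by (rule suminf_mult2[symmetric])
  finally show ?thesis .
qed

lemma filter_converges_white_noise:
  fixes \<epsilon> :: "int \<Rightarrow> 'w \<Rightarrow> real"
  assumes wn: "white_noise M \<epsilon>" and f: "summable (\<lambda>k. \<bar>fps_nth f k\<bar>)"
  shows "filter_converges M f \<epsilon> t"
proof -
  define g where "g = fps_nth f"
  define x where "x = (\<lambda>k. \<epsilon> (t - int k))"
  have meas [measurable]: "x k \<in> borel_measurable M" for k
    using wn by (simp add: white_noise_def x_def)
  have int: "integrable M (\<lambda>\<omega>. (x k \<omega>)\<^sup>2)" for k
    using wn by (simp add: white_noise_def x_def)
  obtain \<sigma>2 where var: "(\<integral>\<omega>. (x k \<omega>)\<^sup>2 \<partial>M) = \<sigma>2" for k
    using wn by (auto simp: white_noise_def x_def)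
  have g: "summable (\<lambda>k. \<bar>g k\<bar>)"
    using f by (simp add: g_def)
  have gn: "summable (\<lambda>k. \<bar>g (k + n)\<bar>)" for n
    using g by (subst summable_iff_shift)
  have "AE \<omega> in M. (\<Sum>k. ennreal (\<bar>g k\<bar> * (x k \<omega>)\<^sup>2)) \<noteq> \<infinity>"
    by (rule nn_integral_PInf_AE) (simp_all add: nn_integral_weighted_squares[OF meas int var g])
  then have sm2: "AE \<omega> in M. summable (\<lambda>k. \<bar>g k\<bar> * (x k \<omega>)\<^sup>2)"
    by eventually_elim (rule summable_suminf_not_top, auto)
  have sm_abs: "summable (\<lambda>k. \<bar>g k * x k \<omega>\<bar>)" if "summable (\<lambda>k. \<bar>g k\<bar> * (x k \<omega>)\<^sup>2)" for \<omega>
  proof (rule summable_comparison_test)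
    show "summable (\<lambda>k. \<bar>g k\<bar> + \<bar>g k\<bar> * (x k \<omega>)\<^sup>2)"
      by (intro summable_add g that)
    \<comment> \<open>From (\<bar>y\<bar> - 1)^2 \<ge> 0. It trades the first power for a constant
      and a square, both summable against \<bar>g\<bar>.\<close>
    have "\<bar>y\<bar> \<le> 1 + y\<^sup>2" for y :: real
      using zero_le_power2[of "\<bar>y\<bar> - 1"] unfolding power2_diff by simp
    then have "\<bar>g k\<bar> * \<bar>x k \<omega>\<bar> \<le> \<bar>g k\<bar> * (1 + (x k \<omega>)\<^sup>2)" for k
      by (intro mult_left_mono) auto
    then show "\<exists>N. \<forall>k\<ge>N. norm \<bar>g k * x k \<omega>\<bar> \<le> \<bar>g k\<bar> + \<bar>g k\<bar> * (x k \<omega>)\<^sup>2"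
      by (auto simp: abs_mult distrib_left)
  qed
  \<comment> \<open>The mean-square error after n terms is at most A_n^2 \<sigma>^2: one factor A_n
    comes from Cauchy-Schwarz, the other from integrating the weighted squares.\<close>
  define A where "A = (\<lambda>n. \<Sum>k. \<bar>g (k + n)\<bar>)"
  have A0: "A n \<ge> 0" for n
    unfolding A_def by (rule suminf_nonneg[OF gn]) simp
  have "(\<lambda>n. (\<Sum>k. \<bar>g k\<bar>) - (\<Sum>k<n. \<bar>g k\<bar>)) \<longlonglongrightarrow> (\<Sum>k. \<bar>g k\<bar>) - (\<Sum>k. \<bar>g k\<bar>)"
    by (intro tendsto_diff tendsto_const summable_LIMSEQ g)
  then have A_lim: "A \<longlonglongrightarrow> 0"
    unfolding A_def by (subst suminf_minus_initial_segment[OF g]) simp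
  define E where "E = (\<lambda>n. \<integral>\<^sup>+\<omega>. ennreal (((\<Sum>k<n. g k * x k \<omega>) - (\<Sum>k. g k * x k \<omega>))\<^sup>2) \<partial>M)"
  have E_le: "E n \<le> ennreal (A n * (A n * \<sigma>2))" for n
  proof -
    have "E n \<le> (\<integral>\<^sup>+\<omega>. ennreal (A n) * (\<Sum>k. ennreal (\<bar>g (k + n)\<bar> * (x (k + n) \<omega>)\<^sup>2)) \<partial>M)"
      unfolding E_def
    proof (rule nn_integral_mono_AE, use sm2 in eventually_elim)
      fix \<omega> assume s2: "summable (\<lambda>k. \<bar>g k\<bar> * (x k \<omega>)\<^sup>2)"
      have s1: "summable (\<lambda>k. g k * x k \<omega>)"
        using sm_abs[OF s2] by (rule summable_rabs_cancel)
      have s1n: "summable (\<lambda>k. g (k + n) * x (k + n) \<omega>)"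
        using s1 by (subst summable_iff_shift[where f = "\<lambda>k. g k * x k \<omega>"])
      have s2n: "summable (\<lambda>k. \<bar>g (k + n)\<bar> * (x (k + n) \<omega>)\<^sup>2)"
        using s2 by (subst summable_iff_shift[where f = "\<lambda>k. \<bar>g k\<bar> * (x k \<omega>)\<^sup>2"])
      have "((\<Sum>k<n. g k * x k \<omega>) - (\<Sum>k. g k * x k \<omega>))\<^sup>2 = (\<Sum>k. g (k + n) * x (k + n) \<omega>)\<^sup>2"
        unfolding suminf_minus_initial_segment[OF s1] by (rule power2_commute)
      also have "\<dots> \<le> A n * (\<Sum>k. \<bar>g (k + n)\<bar> * (x (k + n) \<omega>)\<^sup>2)"
        unfolding A_def by (rule suminf_Cauchy_Schwarz_weighted[OF gn s2n s1n])
      finally show "ennreal (((\<Sum>k<n. g k * x k \<omega>) - (\<Sum>k. g k * x k \<omega>))\<^sup>2)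
          \<le> ennreal (A n) * (\<Sum>k. ennreal (\<bar>g (k + n)\<bar> * (x (k + n) \<omega>)\<^sup>2))"
        using A0 s2n by (simp add: suminf_ennreal2 ennreal_mult[symmetric] suminf_nonneg ennreal_leI)
    qed
    also have "\<dots> = ennreal (A n) * (\<integral>\<^sup>+\<omega>. (\<Sum>k. ennreal (\<bar>g (k + n)\<bar> * (x (k + n) \<omega>)\<^sup>2)) \<partial>M)"
      by (rule nn_integral_cmult) measurable
    also have "(\<integral>\<^sup>+\<omega>. (\<Sum>k. ennreal (\<bar>g (k + n)\<bar> * (x (k + n) \<omega>)\<^sup>2)) \<partial>M) = ennreal (A n * \<sigma>2)"
      unfolding A_def by (rule nn_integral_weighted_squares[OF meas int var gn])
    also have "ennreal (A n) * ennreal (A n * \<sigma>2) = ennreal (A n * (A n * \<sigma>2))"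
      using A0 by (rule ennreal_mult'[symmetric])
    finally show ?thesis .
  qed
  have "E \<longlonglongrightarrow> 0"
  proof (rule tendsto_sandwich[of "\<lambda>_. 0" E sequentially "\<lambda>n. ennreal (A n * (A n * \<sigma>2))"])
    have "(\<lambda>n. A n * (A n * \<sigma>2)) \<longlonglongrightarrow> 0 * (0 * \<sigma>2)"
      by (intro tendsto_mult tendsto_const A_lim)
    then show "(\<lambda>n. ennreal (A n * (A n * \<sigma>2))) \<longlonglongrightarrow> 0"
      using tendsto_ennrealI by fastforce
  qed (use E_le in auto)
  moreover have "AE \<omega> in M. summable (\<lambda>k. \<bar>g k * x k \<omega>\<bar>)"
    using sm2 by eventually_elim (rule sm_abs)
  ultimately show ?thesis
    by (simp add: filter_converges_def lag_filter_def E_def g_def x_def)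
qed

text \<open>Pathwise form of a(L) (1/a(L)) \<epsilon> = \<epsilon>, by summing the coefficient
  recurrence against the noise. Summability is asked at every time \<open>s\<close> because lagged
  filters enter.\<close>

lemma lag_filter_inv_lag:
  fixes \<epsilon> :: "int \<Rightarrow> 'w \<Rightarrow> real"
  assumes sm: "\<And>s. summable (\<lambda>k. fps_nth (inv_lag a) k * \<epsilon> (s - int k) \<omega>)"
  shows "lag_filter (inv_lag a) \<epsilon> t \<omega> =
    \<epsilon> t \<omega> - (\<Sum>j<dim_vec a. a $ j * lag_filter (inv_lag a) \<epsilon> (t - int (Suc j)) \<omega>)"
proof -
  \<comment> \<open>Padding with j leading zeros puts all lagged filters on the same index k, so the
    recurrence applies term by term.\<close>
  have "(\<lambda>k. lag_coeff a k j * \<epsilon> (t - int (Suc k)) \<omega>) sums lag_filter (inv_lag a) \<epsilon> (t - int (Suc j)) \<omega>" for j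
  proof -
    have "(\<lambda>k. fps_nth (inv_lag a) k * \<epsilon> (t - int (Suc j) - int k) \<omega>)
        sums lag_filter (inv_lag a) \<epsilon> (t - int (Suc j)) \<omega>"
      unfolding lag_filter_def by (rule summable_sums[OF sm])
    also have "(\<lambda>k. fps_nth (inv_lag a) k * \<epsilon> (t - int (Suc j) - int k) \<omega>) =
        (\<lambda>k. lag_coeff a (k + j) j * \<epsilon> (t - int (Suc (k + j))) \<omega>)"
      by (simp add: lag_coeff_def algebra_simps)
    finally show ?thesis
      by (subst (asm) sums_zero_iff_shift) (auto simp: lag_coeff_def)
  qed
  then have "(\<lambda>k. - (\<Sum>j<dim_vec a. a $ j * (lag_coeff a k j * \<epsilon> (t - int (Suc k)) \<omega>)))
      sums - (\<Sum>j<dim_vec a. a $ j * lag_filter (inv_lag a) \<epsilon> (t - int (Suc j)) \<omega>)"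
    by (intro sums_minus sums_sum sums_mult)
  also have "(\<lambda>k. - (\<Sum>j<dim_vec a. a $ j * (lag_coeff a k j * \<epsilon> (t - int (Suc k)) \<omega>))) =
      (\<lambda>k. fps_nth (inv_lag a) (Suc k) * \<epsilon> (t - int (Suc k)) \<omega>)"
    by (simp add: inv_lag_Suc sum_distrib_right mult.assoc)
  \<comment> \<open>The recurrence covers the coefficients from index 1 on; index 0 has coefficient
    1 and contributes the current noise.\<close>
  finally have "(\<lambda>k. fps_nth (inv_lag a) k * \<epsilon> (t - int k) \<omega>)
      sums (- (\<Sum>j<dim_vec a. a $ j * lag_filter (inv_lag a) \<epsilon> (t - int (Suc j)) \<omega>) + \<epsilon> t \<omega>)"
    by (subst (asm) sums_Suc_iff) (simp add: inv_lag_0)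
  then show ?thesis
    unfolding lag_filter_def[of _ _ t] by (simp add: sums_iff)
qed

subsection \<open>The state matrix\<close>

lemma companion_block_carrier: "companion_block a \<in> carrier_mat (dim_vec a) (dim_vec a)"
  by (rule carrier_matI) (simp_all add: companion_block_def shift_mat_def)

lemma companion_block_index:
  assumes "i < dim_vec a" "j < dim_vec a"
  shows "companion_block a $$ (i, j) = (if i = j + 1 then 1 else 0) - (if i = 0 then a $ j else 0)"
  using assms by (auto simp: companion_block_def shift_mat_def scalar_prod_def mat_of_cols_index mat_of_row_def)

text \<open>J moves entries down one place and -e a^T supplies the first entry. A general real field
  is used because the state equation needs real vectors, eigenvectors and the transfer function
  complex ones.\<close>

lemma companion_block_mult_vec:
  fixes u :: "'a::real_field Matrix.vec"
  assumes "u \<in> carrier_vec (dim_vec a)"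
  shows "map_mat of_real (companion_block a) *\<^sub>v u = Matrix.vec (dim_vec a)
    (\<lambda>i. if i = 0 then - (\<Sum>j<dim_vec a. of_real (a $ j) * u $ j) else u $ (i - 1))"
proof (rule eq_vecI)
  fix i assume "i < dim_vec (Matrix.vec (dim_vec a)
    (\<lambda>i. if i = 0 then - (\<Sum>j<dim_vec a. of_real (a $ j) * u $ j) else u $ (i - 1)))"
  then have i: "i < dim_vec a" by simp
  have "(map_mat of_real (companion_block a) *\<^sub>v u) $ i =
      (\<Sum>j<dim_vec a. of_real (companion_block a $$ (i, j)) * u $ j)"
    using assms i companion_block_carrier[of a]
    by (simp add: scalar_prod_def atLeast0LessThan)
  also have "\<dots> = (\<Sum>j<dim_vec a. (if j = i - 1 \<and> i \<noteq> 0 then u $ j else 0)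
      - (if i = 0 then of_real (a $ j) * u $ j else 0))"
    using i by (intro sum.cong refl) (auto simp: companion_block_index)
  also have "\<dots> = (if i = 0 then - (\<Sum>j<dim_vec a. of_real (a $ j) * u $ j) else u $ (i - 1))"
    using i by (cases "i = 0") (auto simp: sum_negf)
  finally show "(map_mat of_real (companion_block a) *\<^sub>v u) $ i = Matrix.vec (dim_vec a)
      (\<lambda>i. if i = 0 then - (\<Sum>j<dim_vec a. of_real (a $ j) * u $ j) else u $ (i - 1)) $ i"
    using i by simp
qed (use companion_block_carrier[of a] in simp)

lemma F_mat_carrier: "F_mat a c \<in> carrier_mat (dim_vec a + dim_vec c) (dim_vec a + dim_vec c)"
  unfolding F_mat_def by (intro four_block_carrier_mat companion_block_carrier)

lemma F_mat_mult_vec: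
  fixes u w :: "'a::real_field Matrix.vec"
  assumes "u \<in> carrier_vec (dim_vec a)" "w \<in> carrier_vec (dim_vec c)"
  shows "map_mat of_real (F_mat a c) *\<^sub>v (u @\<^sub>v w) =
    map_mat of_real (companion_block a) *\<^sub>v u @\<^sub>v map_mat of_real (companion_block c) *\<^sub>v w"
proof -
  have "map_mat of_real (F_mat a c) = four_block_mat
      (map_mat of_real (companion_block a)) (0\<^sub>m (dim_vec a) (dim_vec c))
      (0\<^sub>m (dim_vec c) (dim_vec a)) (map_mat (of_real :: real \<Rightarrow> 'a) (companion_block c))"
    unfolding F_mat_def
    by (subst map_four_block_mat[OF companion_block_carrier _ _ companion_block_carrier])
      (auto intro!: arg_cong2[of _ _ _ _ "four_block_mat _"] arg_cong2[of _ _ _ _ "\<lambda>B C. four_block_mat _ B C _"])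
  then show ?thesis
    using companion_block_carrier assms by (simp add: mult_mat_vec_split)
qed

lemma map_mat_of_real_real: "map_mat (of_real :: real \<Rightarrow> real) A = A"
  by (rule eq_matI) auto

text \<open>F takes each coefficient vector to the next: the shift is
  \<open>lag_coeff a (Suc k) (Suc i) = lag_coeff a k i\<close>, the first row is
  \<open>inv_lag_Suc\<close>. The vector at k = 0 is B.\<close>

lemma F_mat_power_B_vec:
  "(F_mat a c ^\<^sub>m k) *\<^sub>v B_vec (dim_vec a) (dim_vec c) =
    Matrix.vec (dim_vec a) (lag_coeff a k) @\<^sub>v - Matrix.vec (dim_vec c) (lag_coeff c k)"
proof -
  define w where "w k = Matrix.vec (dim_vec a) (lag_coeff a k) @\<^sub>v - Matrix.vec (dim_vec c) (lag_coeff c k)" for k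
  have step: "F_mat a c *\<^sub>v w k = w (Suc k)" for k
  proof -
    have "companion_block a *\<^sub>v Matrix.vec (dim_vec a) (lag_coeff a k) = Matrix.vec (dim_vec a) (lag_coeff a (Suc k))"
      by (subst companion_block_mult_vec[where 'a = real, unfolded map_mat_of_real_real])
        (auto simp: lag_coeff_def inv_lag_Suc intro!: eq_vecI)
    moreover have "companion_block c *\<^sub>v - Matrix.vec (dim_vec c) (lag_coeff c k) = - Matrix.vec (dim_vec c) (lag_coeff c (Suc k))"
      by (subst companion_block_mult_vec[where 'a = real, unfolded map_mat_of_real_real])
        (auto simp: lag_coeff_def inv_lag_Suc sum_negf intro!: eq_vecI)
    ultimately show ?thesis
      unfolding w_def
      by (subst F_mat_mult_vec[where 'a = real, unfolded map_mat_of_real_real]) auto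
  qed
  have w: "w k \<in> carrier_vec (dim_vec a + dim_vec c)" for k
    by (auto simp: w_def)
  \<comment> \<open>The start m is arbitrary because the power unfolds as F^k F: in the induction
    step F acts first and advances m.\<close>
  have "(F_mat a c ^\<^sub>m k) *\<^sub>v w m = w (k + m)" for m
  proof (induction k arbitrary: m)
    case 0
    then show ?case using w[of m] F_mat_carrier[of a c] by simp
  next
    case (Suc k)
    have "(F_mat a c ^\<^sub>m Suc k) *\<^sub>v w m = (F_mat a c ^\<^sub>m k) *\<^sub>v (F_mat a c *\<^sub>v w m)"
      using assoc_mult_mat_vec[OF pow_carrier_mat[OF F_mat_carrier] F_mat_carrier w] by simp
    then show ?case by (simp add: step Suc)
  qed
  from this[of 0] have "(F_mat a c ^\<^sub>m k) *\<^sub>v w 0 = w k" by simp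
  moreover have "w 0 = B_vec (dim_vec a) (dim_vec c)"
    by (auto simp: w_def B_vec_def lag_coeff_def inv_lag_0 unit_vec_def intro!: eq_vecI arg_cong2[where f = "(@\<^sub>v)"])
  ultimately show ?thesis by (simp add: w_def)
qed

section \<open>Eigenvalues of F and existence of the resolvent\<close>

text \<open>The rows below the first read u_(i-1) = z u_i, so u is a multiple of (z^(p-1), ..., z,
  1); the first row then says hat a(z) u_(p-1) = 0.\<close>

lemma companion_block_eigenvector:
  fixes u :: "complex Matrix.vec"
  assumes u: "u \<in> carrier_vec (dim_vec a)" "u \<noteq> 0\<^sub>v (dim_vec a)"
    and eig: "map_mat of_real (companion_block a) *\<^sub>v u = z \<cdot>\<^sub>v u"
  shows "z \<in> complex_zeros (hat_poly a)"
proof -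
  define p where "p = dim_vec a"
  have "p > 0"
  proof (rule ccontr)
    assume "\<not> p > 0"
    then have "u = 0\<^sub>v (dim_vec a)" using u(1) by (intro eq_vecI) (auto simp: p_def)
    then show False using u(2) by simp
  qed
  have eig_i: "z * u $ i = (if i = 0 then - (\<Sum>j<p. of_real (a $ j) * u $ j) else u $ (i - 1))"
    if "i < p" for i
    using arg_cong[OF eig[symmetric], of "\<lambda>v. v $ i"] that u(1)
    by (cases "i = 0") (simp_all add: companion_block_mult_vec p_def)
  have u_eq: "u $ (p - Suc k) = z ^ k * u $ (p - 1)" if "k < p" for k
    using that
  proof (induction k)
    case (Suc k)
    then have "u $ (p - Suc (Suc k)) = z * u $ (p - Suc k)"
      using eig_i[of "p - Suc k"] by simp
    then show ?case using Suc by simp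
  qed simp
  have u_eq': "u $ j = z ^ (p - Suc j) * u $ (p - 1)" if "j < p" for j
    using u_eq[of "p - Suc j"] that by simp
  have "u $ (p - 1) \<noteq> 0"
  proof
    assume "u $ (p - 1) = 0"
    then have "u = 0\<^sub>v (dim_vec a)"
      using u(1) u_eq' by (intro eq_vecI) (auto simp: p_def)
    then show False using u(2) by simp
  qed
  have "poly (map_poly complex_of_real (hat_poly a)) z * u $ (p - 1) =
      z ^ p * u $ (p - 1) + (\<Sum>j<p. of_real (a $ j) * (z ^ (p - Suc j) * u $ (p - 1)))"
    by (simp add: poly_hat_poly p_def distrib_right sum_distrib_right mult.assoc)
  also have "(\<Sum>j<p. of_real (a $ j) * (z ^ (p - Suc j) * u $ (p - 1))) = (\<Sum>j<p. of_real (a $ j) * u $ j)"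
    by (intro sum.cong refl) (simp only: u_eq'[symmetric] lessThan_iff)
  also have "z ^ p * u $ (p - 1) = z * u $ 0"
    using u_eq'[of 0] \<open>p > 0\<close> by (cases p) auto
  also have "z * u $ 0 + (\<Sum>j<p. of_real (a $ j) * u $ j) = 0"
    using eig_i[of 0] \<open>p > 0\<close> by simp
  finally show ?thesis
    using \<open>u $ (p - 1) \<noteq> 0\<close> by (simp add: complex_zeros_def)
qed

text \<open>F is block diagonal, so each part of v satisfies the eigenvalue equation of its block,
  and at least one part is nonzero.\<close>

lemma F_mat_eigenvector:
  fixes v :: "complex Matrix.vec"
  assumes v: "v \<in> carrier_vec (dim_vec a + dim_vec c)" "v \<noteq> 0\<^sub>v (dim_vec a + dim_vec c)"
    and eig: "map_mat of_real (F_mat a c) *\<^sub>v v = z \<cdot>\<^sub>v v"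
  shows "z \<in> complex_zeros (hat_poly a) \<union> complex_zeros (hat_poly c)"
proof -
  define u w where "u = vec_first v (dim_vec a)" and "w = vec_last v (dim_vec c)"
  have uw [simp]: "u \<in> carrier_vec (dim_vec a)" "w \<in> carrier_vec (dim_vec c)"
    by (auto simp: u_def w_def)
  have v_eq: "v = u @\<^sub>v w"
    using v(1) by (simp add: u_def w_def)
  have "map_mat of_real (companion_block a) *\<^sub>v u @\<^sub>v map_mat of_real (companion_block c) *\<^sub>v w
      = z \<cdot>\<^sub>v u @\<^sub>v z \<cdot>\<^sub>v w"
    using eig unfolding v_eq by (simp add: F_mat_mult_vec) (auto intro!: eq_vecI)
  then have "map_mat of_real (companion_block a) *\<^sub>v u = z \<cdot>\<^sub>v u"
      "map_mat of_real (companion_block c) *\<^sub>v w = z \<cdot>\<^sub>v w"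
    by (subst (asm) append_vec_eq[of _ "dim_vec a"]; use companion_block_carrier[of a] in auto)+
  moreover have "u \<noteq> 0\<^sub>v (dim_vec a) \<or> w \<noteq> 0\<^sub>v (dim_vec c)"
    using v(2) by (auto simp: v_eq)
  ultimately show ?thesis
    using companion_block_eigenvector uw by blast
qed

lemma resolvent_exists:
  assumes "z \<notin> complex_zeros (hat_poly a) \<union> complex_zeros (hat_poly c)"
  defines "n \<equiv> dim_vec a + dim_vec c"
  defines "N \<equiv> z \<cdot>\<^sub>m 1\<^sub>m n - map_mat complex_of_real (F_mat a c)"
  obtains R where "R \<in> carrier_mat n n" "R * N = 1\<^sub>m n" "N * R = 1\<^sub>m n"
proof -
  have N: "N \<in> carrier_mat n n"
    using F_mat_carrier[of a c] by (auto simp: N_def n_def)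
  \<comment> \<open>A nonzero kernel vector of zI - F would be an eigenvector of F for z.\<close>
  have "Determinant.det N \<noteq> 0"
  proof
    assume "Determinant.det N = 0"
    then obtain v where v: "v \<in> carrier_vec n" "v \<noteq> 0\<^sub>v n" "N *\<^sub>v v = 0\<^sub>v n"
      using det_0_iff_vec_prod_zero[OF N] by auto
    have "N *\<^sub>v v = z \<cdot>\<^sub>v v - map_mat complex_of_real (F_mat a c) *\<^sub>v v"
      using F_mat_carrier[of a c] v(1) unfolding N_def n_def
      by (subst minus_mult_distrib_mat_vec[where nr = "dim_vec a + dim_vec c" and nc = "dim_vec a + dim_vec c"]) auto
    then have "map_mat complex_of_real (F_mat a c) *\<^sub>v v = z \<cdot>\<^sub>v v"
      using v(3) v(1) F_mat_carrier[of a c]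
      by (intro eq_vecI) (auto simp: n_def vec_eq_iff)
    then show False
      using F_mat_eigenvector[of v a c z] v assms(1) by (auto simp: n_def)
  qed
  from det_non_zero_imp_unit[OF N this, of "()"] show ?thesis
    using that by (auto simp: Units_def ring_mat_def)
qed

section \<open>The transfer function from noise to state\<close>

text \<open>\<open>u_star\<close> satisfies every row of the eigenvalue equation for z except the
  first, where the defect is hat a(z). Suitable scaling turns this defect into the entry of
  B.\<close>

lemma companion_block_mult_u_star:
  "map_mat complex_of_real (companion_block a) *\<^sub>v (s \<cdot>\<^sub>v u_star (dim_vec a) z) =
    z \<cdot>\<^sub>v (s \<cdot>\<^sub>v u_star (dim_vec a) z)
      - (s * poly (map_poly complex_of_real (hat_poly a)) z) \<cdot>\<^sub>v unit_vec (dim_vec a) 0"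
proof (subst companion_block_mult_vec)
  show "s \<cdot>\<^sub>v u_star (dim_vec a) z \<in> carrier_vec (dim_vec a)"
    by (simp add: u_star_def)
  define p where "p = dim_vec a"
  have "(if i = 0 then - (\<Sum>j<p. complex_of_real (a $ j) * (s \<cdot>\<^sub>v u_star p z) $ j)
        else (s \<cdot>\<^sub>v u_star p z) $ (i - 1)) =
      z * (s * z ^ (p - 1 - i)) - s * poly (map_poly complex_of_real (hat_poly a)) z * (if i = 0 then 1 else 0)"
    if "i < p" for i
  proof (cases i)
    case 0
    have "z ^ p = z * z ^ (p - 1)"
      using that by (simp flip: power_Suc)
    then show ?thesis
      using 0 by (simp add: u_star_def poly_hat_poly p_def[symmetric] algebra_simps sum_distrib_left)
  next
    case (Suc k)
    then have "p - 1 - k = Suc (p - 1 - i)"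
      using that by simp
    then show ?thesis
      using Suc that by (simp add: u_star_def)
  qed
  then show "Matrix.vec (dim_vec a) (\<lambda>i. if i = 0
        then - (\<Sum>j<dim_vec a. complex_of_real (a $ j) * (s \<cdot>\<^sub>v u_star (dim_vec a) z) $ j)
        else (s \<cdot>\<^sub>v u_star (dim_vec a) z) $ (i - 1)) =
      z \<cdot>\<^sub>v (s \<cdot>\<^sub>v u_star (dim_vec a) z)
        - (s * poly (map_poly complex_of_real (hat_poly a)) z) \<cdot>\<^sub>v unit_vec (dim_vec a) 0"
    unfolding p_def by (intro eq_vecI) (auto simp: u_star_def unit_vec_def)
qed

lemma resolvent_times_tau:
  assumes z: "z \<notin> complex_zeros (hat_poly a) \<union> complex_zeros (hat_poly c)"
  defines "n \<equiv> dim_vec a + dim_vec c"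
  shows "(z \<cdot>\<^sub>m 1\<^sub>m n - map_mat complex_of_real (F_mat a c)) *\<^sub>v tau a c z =
    map_vec complex_of_real (B_vec (dim_vec a) (dim_vec c))"
proof -
  \<comment> \<open>These scalars normalise the two defects to 1 and -1, the signs in B.\<close>
  define s r where "s = 1 / poly (map_poly complex_of_real (hat_poly a)) z"
    and "r = - (1 / poly (map_poly complex_of_real (hat_poly c)) z)"
  define u w where "u = s \<cdot>\<^sub>v u_star (dim_vec a) z" and "w = r \<cdot>\<^sub>v u_star (dim_vec c) z"
  have uw: "u \<in> carrier_vec (dim_vec a)" "w \<in> carrier_vec (dim_vec c)"
    by (auto simp: u_def w_def u_star_def)
  have tau: "tau a c z = u @\<^sub>v w"
    by (simp add: tau_def u_def w_def s_def r_def)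
  have "s * poly (map_poly complex_of_real (hat_poly a)) z = 1"
      "r * poly (map_poly complex_of_real (hat_poly c)) z = -1"
    using z by (auto simp: s_def r_def complex_zeros_def)
  then have F: "map_mat complex_of_real (F_mat a c) *\<^sub>v tau a c z =
      (z \<cdot>\<^sub>v u - 1 \<cdot>\<^sub>v unit_vec (dim_vec a) 0) @\<^sub>v (z \<cdot>\<^sub>v w - (-1) \<cdot>\<^sub>v unit_vec (dim_vec c) 0)"
    unfolding tau using uw
    by (simp add: F_mat_mult_vec) (simp add: u_def w_def companion_block_mult_u_star)
  have "(z \<cdot>\<^sub>m 1\<^sub>m n - map_mat complex_of_real (F_mat a c)) *\<^sub>v tau a c z =
      z \<cdot>\<^sub>v tau a c z - map_mat complex_of_real (F_mat a c) *\<^sub>v tau a c z"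
    using F_mat_carrier[of a c] uw unfolding n_def tau
    by (subst minus_mult_distrib_mat_vec[where nr = "dim_vec a + dim_vec c" and nc = "dim_vec a + dim_vec c"]) auto
  also have "\<dots> = map_vec complex_of_real (B_vec (dim_vec a) (dim_vec c))"
    unfolding F unfolding tau using uw
    by (intro eq_vecI) (auto simp: B_vec_def unit_vec_def)
  finally show ?thesis .
qed

section \<open>The state equation of the derivative process\<close>

lemma xi_process_Suc:
  assumes sm: "\<And>s. summable (\<lambda>k. fps_nth (inv_lag a) k * \<epsilon> (s - int k) \<omega>)"
      "\<And>s. summable (\<lambda>k. fps_nth (inv_lag c) k * \<epsilon> (s - int k) \<omega>)"
  shows "xi_process a c \<epsilon> (t + 1) \<omega> =
    F_mat a c *\<^sub>v xi_process a c \<epsilon> t \<omega> + \<epsilon> t \<omega> \<cdot>\<^sub>v B_vec (dim_vec a) (dim_vec c)"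
proof -
  \<comment> \<open>The sign of the c-part is left out so that one recursion serves both blocks;
    linearity restores it afterwards.\<close>
  define u where "u s b = Matrix.vec (dim_vec b) (\<lambda>i. lag_filter (inv_lag b) \<epsilon> (s - int (Suc i)) \<omega>)" for s b
  have step: "u (t + 1) b = companion_block b *\<^sub>v u t b + \<epsilon> t \<omega> \<cdot>\<^sub>v unit_vec (dim_vec b) 0"
    if "\<And>s. summable (\<lambda>k. fps_nth (inv_lag b) k * \<epsilon> (s - int k) \<omega>)" for b
  proof (subst companion_block_mult_vec[where 'a = real, unfolded map_mat_of_real_real])
    show "u (t + 1) b = Matrix.vec (dim_vec b) (\<lambda>i. if i = 0 then - (\<Sum>j<dim_vec b. of_real (b $ j) * u t b $ j)
        else u t b $ (i - 1)) + \<epsilon> t \<omega> \<cdot>\<^sub>v unit_vec (dim_vec b) 0"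
    proof (rule eq_vecI)
      fix i assume "i < dim_vec (Matrix.vec (dim_vec b) (\<lambda>i. if i = 0 then - (\<Sum>j<dim_vec b. of_real (b $ j) * u t b $ j)
        else u t b $ (i - 1)) + \<epsilon> t \<omega> \<cdot>\<^sub>v unit_vec (dim_vec b) 0)"
      then have "i < dim_vec b" by simp
      then show "u (t + 1) b $ i = (Matrix.vec (dim_vec b) (\<lambda>i. if i = 0 then - (\<Sum>j<dim_vec b. of_real (b $ j) * u t b $ j)
        else u t b $ (i - 1)) + \<epsilon> t \<omega> \<cdot>\<^sub>v unit_vec (dim_vec b) 0) $ i"
        using lag_filter_inv_lag[of b \<epsilon> \<omega> t, OF that] by (cases i) (simp_all add: u_def algebra_simps)
    qed (simp add: u_def)
  qed (simp add: u_def)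
  have xi: "xi_process a c \<epsilon> s \<omega> = u s a @\<^sub>v - u s c" for s
    by (auto simp: xi_process_def u_def intro!: eq_vecI)
  have u: "u s b \<in> carrier_vec (dim_vec b)" for s b
    by (simp add: u_def)
  have neg: "companion_block c *\<^sub>v - u t c = - (companion_block c *\<^sub>v u t c)"
    using companion_block_carrier[of c] u[of t c] by (intro eq_vecI) auto
  have "F_mat a c *\<^sub>v xi_process a c \<epsilon> t \<omega> = companion_block a *\<^sub>v u t a @\<^sub>v - (companion_block c *\<^sub>v u t c)"
    unfolding xi neg[symmetric]
    by (rule F_mat_mult_vec[where 'a = real, unfolded map_mat_of_real_real]) (use u in auto)
  then show ?thesis
    unfolding xi using companion_block_carrier[of a] companion_block_carrier[of c] u
    by (auto simp: step[OF sm(1)] step[OF sm(2)] B_vec_def intro!: eq_vecI)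
qed

subsection \<open>Controllability\<close>

text \<open>Full rank means that the transposed controllability matrix has trivial kernel.
  Nonvanishing of its determinant is stable under field extension, so annihilating vectors may be
  complex, as nonreal common zeros require.\<close>

lemma controllable_iff:
  assumes F: "F \<in> carrier_mat n n" and B: "B \<in> carrier_vec n"
  shows "controllable F B \<longleftrightarrow> (\<forall>y :: 'a::real_field Matrix.vec. y \<in> carrier_vec n \<longrightarrow>
    (\<forall>k<n. map_vec of_real ((F ^\<^sub>m k) *\<^sub>v B) \<bullet> y = 0) \<longrightarrow> y = 0\<^sub>v n)"
proof -
  let ?C = "controllability_mat F B"
  let ?D = "transpose_mat (map_mat (of_real :: real \<Rightarrow> 'a) ?C)"
  have C: "?C \<in> carrier_mat n n"
    using F by (intro carrier_matI) (simp_all add: controllability_mat_def)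
  then have D: "?D \<in> carrier_mat n n" by simp
  have rows: "(?D *\<^sub>v y = 0\<^sub>v n) \<longleftrightarrow> (\<forall>k<n. map_vec of_real ((F ^\<^sub>m k) *\<^sub>v B) \<bullet> y = 0)" for y
  proof -
    have "(?D *\<^sub>v y) $ k = map_vec of_real ((F ^\<^sub>m k) *\<^sub>v B) \<bullet> y" if "k < n" for k
    proof -
      have "col ?C k = (F ^\<^sub>m k) *\<^sub>v B"
        using F that unfolding controllability_mat_def
        by (subst col_mat_of_cols) (auto intro: mult_mat_vec_carrier[OF pow_carrier_mat[OF F] B])
      then have "col (map_mat (of_real :: real \<Rightarrow> 'a) ?C) k = map_vec of_real ((F ^\<^sub>m k) *\<^sub>v B)"
        using C that by simp
      then show ?thesis using C that by simp
    qed
    then show ?thesis using D by (auto simp: vec_eq_iff)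
  qed
  have "controllable F B \<longleftrightarrow> Determinant.det ?C \<noteq> 0"
    using F vec_space.det_rank_iff[OF C] by (auto simp: controllable_def)
  also have "\<dots> \<longleftrightarrow> Determinant.det ?D \<noteq> 0"
    using C by (subst det_transpose[of _ n]) (auto simp: of_real_hom.hom_det)
  also have "\<dots> \<longleftrightarrow> (\<forall>y \<in> carrier_vec n. ?D *\<^sub>v y = 0\<^sub>v n \<longrightarrow> y = 0\<^sub>v n)"
    using det_0_iff_vec_prod_zero[OF D] by auto
  finally show ?thesis by (simp add: rows Ball_def)
qed

text \<open>The minus sign in the lower part of F^k B turns annihilation into equality of two
  sums.\<close>

lemma controllable_F_mat_iff:
  "controllable (F_mat a c) (B_vec (dim_vec a) (dim_vec c)) \<longleftrightarrow>
    (\<forall>u w :: 'a::real_field Matrix.vec. u \<in> carrier_vec (dim_vec a) \<longrightarrow> w \<in> carrier_vec (dim_vec c) \<longrightarrow>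
      (\<forall>k < dim_vec a + dim_vec c.
        (\<Sum>i<dim_vec a. of_real (lag_coeff a k i) * u $ i) = (\<Sum>i<dim_vec c. of_real (lag_coeff c k i) * w $ i)) \<longrightarrow>
      u = 0\<^sub>v (dim_vec a) \<and> w = 0\<^sub>v (dim_vec c))"
proof -
  define p q where "p = dim_vec a" and "q = dim_vec c"
  have dot: "map_vec of_real ((F_mat a c ^\<^sub>m k) *\<^sub>v B_vec p q) \<bullet> (u @\<^sub>v w) =
      (\<Sum>i<p. of_real (lag_coeff a k i) * u $ i) - (\<Sum>i<q. of_real (lag_coeff c k i) * w $ i)"
    if "u \<in> carrier_vec p" "w \<in> carrier_vec q" for k and u w :: "'a Matrix.vec"
  proof -
    have "map_vec (of_real :: real \<Rightarrow> 'a) ((F_mat a c ^\<^sub>m k) *\<^sub>v B_vec p q) =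
        Matrix.vec p (\<lambda>i. of_real (lag_coeff a k i)) @\<^sub>v Matrix.vec q (\<lambda>i. - of_real (lag_coeff c k i))"
      using F_mat_power_B_vec[of a c k] by (intro eq_vecI) (auto simp: p_def q_def)
    then show ?thesis
      using that by (simp add: scalar_prod_append[of _ p _ q]) (simp add: scalar_prod_def sum_negf atLeast0LessThan)
  qed
  have "controllable (F_mat a c) (B_vec p q) \<longleftrightarrow> (\<forall>y :: 'a Matrix.vec. y \<in> carrier_vec (p + q) \<longrightarrow>
      (\<forall>k<p + q. map_vec of_real ((F_mat a c ^\<^sub>m k) *\<^sub>v B_vec p q) \<bullet> y = 0) \<longrightarrow> y = 0\<^sub>v (p + q))"
    by (rule controllable_iff) (use F_mat_carrier[of a c] in \<open>auto simp: p_def q_def B_vec_def\<close>)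
  also have "\<dots> \<longleftrightarrow> (\<forall>u w :: 'a Matrix.vec. u \<in> carrier_vec p \<longrightarrow> w \<in> carrier_vec q \<longrightarrow>
      (\<forall>k<p + q. map_vec of_real ((F_mat a c ^\<^sub>m k) *\<^sub>v B_vec p q) \<bullet> (u @\<^sub>v w) = 0) \<longrightarrow> u @\<^sub>v w = 0\<^sub>v (p + q))"
  proof (intro iffI allI impI)
    fix y :: "'a Matrix.vec"
    assume "y \<in> carrier_vec (p + q)"
      and "\<forall>u w :: 'a Matrix.vec. u \<in> carrier_vec p \<longrightarrow> w \<in> carrier_vec q \<longrightarrow>
        (\<forall>k<p + q. map_vec of_real ((F_mat a c ^\<^sub>m k) *\<^sub>v B_vec p q) \<bullet> (u @\<^sub>v w) = 0) \<longrightarrow> u @\<^sub>v w = 0\<^sub>v (p + q)"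
      and "\<forall>k<p + q. map_vec of_real ((F_mat a c ^\<^sub>m k) *\<^sub>v B_vec p q) \<bullet> y = 0"
    then show "y = 0\<^sub>v (p + q)"
      using vec_first_last_append[of y p q] vec_first_carrier[of y p] vec_last_carrier[of y q]
      by (elim allE[of _ "vec_first y p"] allE[of _ "vec_last y q"]) simp
  next
    fix u w :: "'a Matrix.vec"
    assume all: "\<forall>y :: 'a Matrix.vec. y \<in> carrier_vec (p + q) \<longrightarrow>
        (\<forall>k<p + q. map_vec of_real ((F_mat a c ^\<^sub>m k) *\<^sub>v B_vec p q) \<bullet> y = 0) \<longrightarrow> y = 0\<^sub>v (p + q)"
      and "u \<in> carrier_vec p" "w \<in> carrier_vec q"
      and dot0: "\<forall>k<p + q. map_vec of_real ((F_mat a c ^\<^sub>m k) *\<^sub>v B_vec p q) \<bullet> (u @\<^sub>v w) = 0"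
    then have "u @\<^sub>v w \<in> carrier_vec (p + q)" by simp
    then show "u @\<^sub>v w = 0\<^sub>v (p + q)"
      by (rule all[rule_format]) (rule dot0[rule_format])
  qed
  also have "\<dots> \<longleftrightarrow> (\<forall>u w :: 'a Matrix.vec. u \<in> carrier_vec p \<longrightarrow> w \<in> carrier_vec q \<longrightarrow>
      (\<forall>k<p + q. (\<Sum>i<p. of_real (lag_coeff a k i) * u $ i) = (\<Sum>i<q. of_real (lag_coeff c k i) * w $ i)) \<longrightarrow>
      u = 0\<^sub>v p \<and> w = 0\<^sub>v q)"
  proof -
    have "u @\<^sub>v w = 0\<^sub>v (p + q) \<longleftrightarrow> u = 0\<^sub>v p \<and> w = 0\<^sub>v q"
      if "u \<in> carrier_vec p" for u w :: "'a Matrix.vec"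
    proof -
      have "0\<^sub>v (p + q) = (0\<^sub>v p @\<^sub>v 0\<^sub>v q :: 'a Matrix.vec)"
        by (rule eq_vecI) auto
      then show ?thesis
        using append_vec_eq[OF that zero_carrier_vec] by simp
    qed
    then show ?thesis by (simp add: dot)
  qed
  finally show ?thesis by (simp only: p_def q_def)
qed

section \<open>Absence of common zeros implies controllability\<close>

text \<open>A nonconstant common divisor has a complex zero, whose inverse would be a common zero of
  hat a and hat c.\<close>

lemma coprime_lag_poly:
  assumes "complex_zeros (hat_poly a) \<inter> complex_zeros (hat_poly c) = {}"
  shows "coprime (lag_poly a) (lag_poly c)"
proof (rule coprimeI)
  fix d assume "d dvd lag_poly a" "d dvd lag_poly c"
  then obtain e e' where e: "lag_poly a = d * e" "lag_poly c = d * e'"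
    by (auto elim!: dvdE)
  have "degree d = 0"
  proof (rule ccontr)
    assume "degree d \<noteq> 0"
    then obtain z where "poly (map_poly complex_of_real d) z = 0"
      using Fundamental_Theorem_Algebra.fundamental_theorem_of_algebra[of "map_poly complex_of_real d"]
      by (auto simp: constant_degree)
    then have "poly (map_poly complex_of_real (lag_poly a)) z = 0"
        "poly (map_poly complex_of_real (lag_poly c)) z = 0"
      by (simp_all add: e of_real_poly.hom_mult)
    then show False
      using lag_poly_zero_imp_hat_poly_zero(2)[of _ z] assms by blast
  qed
  moreover have "coeff (lag_poly a) 0 \<noteq> 0"
    by (simp add: coeff_lag_poly)
  then have "d \<noteq> 0" by (auto simp: e)
  ultimately show "is_unit d"
    by (simp add: is_unit_iff_degree)
qed

text \<open>Identifies the sums in the annihilation condition as power series coefficients of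
  U/a.\<close>

lemma fps_poly_times_inv_lag_nth:
  assumes "degree U < n"
  shows "fps_nth (fps_of_poly U * inv_lag a) k = (\<Sum>i<n. lag_coeff a k i * coeff U i)"
proof -
  have "fps_nth (fps_of_poly U * inv_lag a) k = (\<Sum>i\<le>k. coeff U i * fps_nth (inv_lag a) (k - i))"
    by (simp add: fps_mult_nth atMost_atLeast0)
  also have "\<dots> = (\<Sum>i\<in>{..<n} \<union> {..k}. lag_coeff a k i * coeff U i)"
    by (rule sum.mono_neutral_cong_left) (auto simp: lag_coeff_def)
  also have "\<dots> = (\<Sum>i<n. lag_coeff a k i * coeff U i)"
    using assms by (intro sum.mono_neutral_right) (auto simp: coeff_eq_0)
  finally show ?thesis .
qed

lemma lag_poly_cross_eq:
  fixes U W :: "real poly"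
  assumes U: "degree U < dim_vec a" and W: "degree W < dim_vec c"
    and eq: "\<And>k. k < dim_vec a + dim_vec c \<Longrightarrow>
      (\<Sum>i<dim_vec a. lag_coeff a k i * coeff U i) = (\<Sum>i<dim_vec c. lag_coeff c k i * coeff W i)"
  shows "U * lag_poly c = W * lag_poly a"
proof (rule poly_eqI)
  fix k
  let ?A = "fps_of_poly (lag_poly a)" and ?C = "fps_of_poly (lag_poly c)"
  \<comment> \<open>This is U/a - W/c. Multiplying by a c gives the polynomial U c - W a, whose
    coefficients below p + q vanish with those of D and whose remaining ones vanish by
    degree.\<close>
  define D where "D = fps_of_poly U * inv_lag a - fps_of_poly W * inv_lag c"
  have D: "fps_nth D k = 0" if "k < dim_vec a + dim_vec c" for k
    using eq[OF that] by (simp add: D_def fps_poly_times_inv_lag_nth[OF U] fps_poly_times_inv_lag_nth[OF W])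
  have "D * (?A * ?C) = fps_of_poly U * ?C * (?A * inv_lag a) - fps_of_poly W * ?A * (?C * inv_lag c)"
    by (simp add: D_def algebra_simps)
  then have DAC: "D * (?A * ?C) = fps_of_poly (U * lag_poly c - W * lag_poly a)"
    by (simp add: lag_poly_times_inv_lag fps_of_poly_mult fps_of_poly_diff)
  show "coeff (U * lag_poly c) k = coeff (W * lag_poly a) k"
  proof (cases "k < dim_vec a + dim_vec c")
    case True
    have "fps_nth (D * (?A * ?C)) k = 0"
      using True by (subst fps_mult_nth) (intro sum.neutral, auto simp: D)
    then show ?thesis unfolding DAC by simp
  next
    case False
    have "degree (U * lag_poly c) < k" "degree (W * lag_poly a) < k"
      using degree_mult_le[of U "lag_poly c"] degree_mult_le[of W "lag_poly a"]
        degree_lag_poly_le[of a] degree_lag_poly_le[of c] U W False by linarith+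
    then show ?thesis by (simp add: coeff_eq_0)
  qed
qed

text \<open>A degree drop means a_p = 0, and a_p is the value of hat a at 0. A common zero at 0 is
  invisible to coprimality of the lag polynomials, so it is caught here.\<close>

lemma zero_in_complex_zeros_hat_poly:
  assumes "dim_vec a \<ge> 1" "degree (lag_poly a) < dim_vec a"
  shows "0 \<in> complex_zeros (hat_poly a)"
proof -
  define p where "p = dim_vec a"
  have "a $ (p - 1) = 0"
    using coeff_eq_0[OF assms(2)] assms(1) by (simp add: coeff_lag_poly p_def split: if_splits)
  have "complex_of_real (a $ j) * 0 ^ (p - Suc j) = 0" if "j < p" for j
    using that \<open>a $ (p - 1) = 0\<close> by (cases "j = p - 1") auto
  then have "(\<Sum>j<p. complex_of_real (a $ j) * 0 ^ (p - Suc j)) = 0"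
    by (intro sum.neutral) (auto simp del: mult_eq_0_iff)
  then show ?thesis
    using assms(1) by (simp add: complex_zeros_def poly_hat_poly flip: p_def)
qed

lemma controllable_if_no_common_zeros:
  assumes dims: "dim_vec a \<ge> 1" "dim_vec c \<ge> 1"
    and disj: "complex_zeros (hat_poly a) \<inter> complex_zeros (hat_poly c) = {}"
  shows "controllable (F_mat a c) (B_vec (dim_vec a) (dim_vec c))"
  unfolding controllable_F_mat_iff[where 'a = real]
proof (intro allI impI)
  fix u w :: "real Matrix.vec"
  assume u: "u \<in> carrier_vec (dim_vec a)" and w: "w \<in> carrier_vec (dim_vec c)"
    and eq: "\<forall>k < dim_vec a + dim_vec c.
      (\<Sum>i<dim_vec a. of_real (lag_coeff a k i) * u $ i) = (\<Sum>i<dim_vec c. of_real (lag_coeff c k i) * w $ i)"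
  define P where "P v = (\<Sum>i<dim_vec v. monom (v $ i) i)" for v :: "real Matrix.vec"
  have coeff_P: "coeff (P v) i = (if i < dim_vec v then v $ i else 0)" for v i
    by (simp add: P_def coeff_sum)
  have deg_P: "degree (P v) < dim_vec v" if "dim_vec v \<ge> 1" for v
    using that by (intro degree_lessI) (auto simp: coeff_P)
  have u_dim: "dim_vec u = dim_vec a" and w_dim: "dim_vec w = dim_vec c"
    using u w by auto
  have degU: "degree (P u) < dim_vec a" and degW: "degree (P w) < dim_vec c"
    using deg_P[of u] deg_P[of w] dims by (simp_all add: u_dim w_dim)
  have cross: "P u * lag_poly c = P w * lag_poly a"
    using eq by (intro lag_poly_cross_eq degU degW) (simp add: coeff_P u_dim w_dim)
  have nz: "lag_poly a \<noteq> 0" "lag_poly c \<noteq> 0"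
    by (auto simp: poly_eq_iff coeff_lag_poly intro!: exI[of _ 0])
  have "lag_poly a dvd P u * lag_poly c"
    by (simp add: cross)
  then have "lag_poly a dvd P u"
    using coprime_dvd_mult_left_iff[OF coprime_lag_poly[OF disj]] by blast
  then obtain S where S: "P u = lag_poly a * S" ..
  then have S': "P w = lag_poly c * S"
    using cross nz by (simp add: algebra_simps)
  have "S = 0"
  proof (rule ccontr)
    assume "S \<noteq> 0"
    \<comment> \<open>deg a + deg S = deg U < p, and likewise for c, so both lag polynomials drop in
      degree.\<close>
    then have "degree (lag_poly a) < dim_vec a" "degree (lag_poly c) < dim_vec c"
      using degU degW nz by (simp_all add: S S' degree_mult_eq)
    then show False
      using zero_in_complex_zeros_hat_poly dims disj by blast
  qed
  then have P0: "P u = 0" "P w = 0"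
    by (simp_all add: S S')
  have "u $ i = 0" if "i < dim_vec a" for i
    using coeff_P[of u i] that by (simp add: P0 u_dim)
  moreover have "w $ i = 0" if "i < dim_vec c" for i
    using coeff_P[of w i] that by (simp add: P0 w_dim)
  ultimately show "u = 0\<^sub>v (dim_vec a) \<and> w = 0\<^sub>v (dim_vec c)"
    by (auto simp: u_dim w_dim intro!: eq_vecI)
qed

text \<open>
  The values \<open>h\<^sub>0, \<dots>, h\<^sub>p\<^sub>-\<^sub>1\<close> of Horner's scheme at a zero \<open>z\<close> form a left eigenvector of the
  companion block.  Paired with \<open>J - e a\<^sup>T\<close> and \<open>J - e c\<^sup>T\<close> at a common zero, they give a
  functional annihilating every \<open>F\<^sup>k B\<close>.
\<close>

primrec horner_partial :: "real Matrix.vec \<Rightarrow> complex \<Rightarrow> nat \<Rightarrow> complex" where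
  "horner_partial a z 0 = 1"
| "horner_partial a z (Suc i) = z * horner_partial a z i + of_real (a $ i)"

text \<open>At i = p the right side is hat a(z), so at a zero the scheme ends in 0.\<close>

lemma horner_partial_eq:
  "horner_partial a z i = z ^ i + (\<Sum>j<i. of_real (a $ j) * z ^ (i - Suc j))"
proof (induction i)
  case (Suc i)
  have "z * (\<Sum>j<i. complex_of_real (a $ j) * z ^ (i - Suc j)) = (\<Sum>j<i. of_real (a $ j) * z ^ (i - j))"
    unfolding sum_distrib_left
    by (intro sum.cong refl) (simp add: Suc_diff_Suc mult.left_commute flip: power_Suc)
  then show ?case by (simp add: Suc distrib_left)
qed simp

text \<open>Each companion step multiplies the pairing with the left eigenvector by z, starting from
  h_0 = 1. The value is free of a, so the a- and c-parts agree at a common zero.\<close>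

lemma sum_lag_coeff_horner_partial:
  assumes "dim_vec a \<ge> 1" and z: "z \<in> complex_zeros (hat_poly a)"
  shows "(\<Sum>i<dim_vec a. of_real (lag_coeff a k i) * horner_partial a z i) = z ^ k"
proof -
  obtain p where p: "dim_vec a = Suc p"
    using assms(1) by (cases "dim_vec a") auto
  have h0: "horner_partial a z (Suc p) = 0"
    using z by (simp add: horner_partial_eq complex_zeros_def poly_hat_poly p del: horner_partial.simps)
  show ?thesis
  proof (induction k)
    case 0
    have "(\<Sum>i<dim_vec a. of_real (lag_coeff a 0 i) * horner_partial a z i) =
        (\<Sum>i<dim_vec a. if i = 0 then 1 else 0)"
      by (intro sum.cong refl) (auto simp: lag_coeff_def inv_lag_0)
    then show ?case by (simp add: p)
  next
    case (Suc k)
    have shift: "lag_coeff a (Suc k) (Suc i) = lag_coeff a k i" for i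
      by (simp add: lag_coeff_def)
    have "(\<Sum>i<dim_vec a. of_real (lag_coeff a (Suc k) i) * horner_partial a z i) =
        of_real (lag_coeff a (Suc k) 0) + (\<Sum>i<p. of_real (lag_coeff a k i) * horner_partial a z (Suc i))"
      unfolding p by (subst sum.lessThan_Suc_shift) (simp add: shift del: horner_partial.simps(2))
    \<comment> \<open>The extra index i = p brings in \<open>horner_partial a z (Suc p)\<close>,
      which is 0.\<close>
    also have "(\<Sum>i<p. of_real (lag_coeff a k i) * horner_partial a z (Suc i)) =
        (\<Sum>i<dim_vec a. of_real (lag_coeff a k i) * horner_partial a z (Suc i))"
      using h0 by (simp add: p del: horner_partial.simps)
    also have "complex_of_real (lag_coeff a (Suc k) 0) = - (\<Sum>i<dim_vec a. of_real (lag_coeff a k i) * of_real (a $ i))"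
      by (simp add: lag_coeff_def[of a "Suc k"] inv_lag_Suc mult.commute)
    also have "- (\<Sum>i<dim_vec a. complex_of_real (lag_coeff a k i) * of_real (a $ i))
        + (\<Sum>i<dim_vec a. of_real (lag_coeff a k i) * horner_partial a z (Suc i)) =
        z * (\<Sum>i<dim_vec a. of_real (lag_coeff a k i) * horner_partial a z i)"
      by (simp add: sum_distrib_left distrib_left sum.distrib mult.left_commute)
    finally show ?case using Suc by simp
  qed
qed

lemma no_common_zeros_if_controllable:
  assumes dims: "dim_vec a \<ge> 1" "dim_vec c \<ge> 1"
    and ctrl: "controllable (F_mat a c) (B_vec (dim_vec a) (dim_vec c))"
  shows "complex_zeros (hat_poly a) \<inter> complex_zeros (hat_poly c) = {}"
proof (rule ccontr)
  assume "complex_zeros (hat_poly a) \<inter> complex_zeros (hat_poly c) \<noteq> {}"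
  then obtain z where z: "z \<in> complex_zeros (hat_poly a)" "z \<in> complex_zeros (hat_poly c)"
    by blast
  let ?h = "\<lambda>a. Matrix.vec (dim_vec a) (horner_partial a z)"
  have "(\<Sum>i<dim_vec a. of_real (lag_coeff a k i) * ?h a $ i) = (\<Sum>i<dim_vec c. of_real (lag_coeff c k i) * ?h c $ i)" for k
    using sum_lag_coeff_horner_partial[OF dims(1) z(1), of k] sum_lag_coeff_horner_partial[OF dims(2) z(2), of k]
    by simp
  \<comment> \<open>The complex form of the criterion is used since z may be nonreal; the
    contradiction is that entry 0 of this vector is 1.\<close>
  then have "?h a = 0\<^sub>v (dim_vec a)"
    using ctrl[unfolded controllable_F_mat_iff[where 'a = complex], rule_format, of "?h a" "?h c"]
    by simp
  then have "?h a $ 0 = 0\<^sub>v (dim_vec a) $ 0" by simp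
  then show False using dims(1) by simp
qed

theorem proposition2p3:
  fixes p q :: nat and a c :: "real Matrix.vec"
    and M :: "'w measure" and \<epsilon> :: "int \<Rightarrow> 'w \<Rightarrow> real"
  assumes "p \<ge> 1" and "q \<ge> 1"
    and "a \<in> carrier_vec p" and "c \<in> carrier_vec q"
    and "\<forall>z \<in> complex_zeros (hat_poly a). cmod z < 1"
    and "\<forall>z \<in> complex_zeros (hat_poly c). cmod z < 1"
    and "white_noise M \<epsilon>"
  shows "(\<forall>t. filter_converges M (inv_lag a) \<epsilon> t \<and> filter_converges M (inv_lag c) \<epsilon> t)
    \<and> (\<forall>t. AE \<omega> in M. xi_process a c \<epsilon> (t + 1) \<omega> =
             F_mat a c *\<^sub>v xi_process a c \<epsilon> t \<omega> + \<epsilon> t \<omega> \<cdot>\<^sub>v B_vec p q)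
    \<and> has_transfer_function_on (F_mat a c) (B_vec p q) (tau a c)
        (- (complex_zeros (hat_poly a) \<union> complex_zeros (hat_poly c)))
    \<and> stable_mat (F_mat a c)
    \<and> (controllable (F_mat a c) (B_vec p q)
         \<longleftrightarrow> complex_zeros (hat_poly a) \<inter> complex_zeros (hat_poly c) = {})"
proof (intro conjI allI)
  have dims: "dim_vec a = p" "dim_vec c = q" and ge: "dim_vec a \<ge> 1" "dim_vec c \<ge> 1"
    using assms by auto
  show conv: "filter_converges M (inv_lag a) \<epsilon> t" "filter_converges M (inv_lag c) \<epsilon> t" for t
    using assms by (simp_all add: filter_converges_white_noise summable_inv_lag)
  show "AE \<omega> in M. xi_process a c \<epsilon> (t + 1) \<omega> =
      F_mat a c *\<^sub>v xi_process a c \<epsilon> t \<omega> + \<epsilon> t \<omega> \<cdot>\<^sub>v B_vec p q" for t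
  proof -
    \<comment> \<open>The times s form a countable set, so the exceptional null sets combine into
      one.\<close>
    have "AE \<omega> in M. \<forall>s. summable (\<lambda>k. \<bar>fps_nth (inv_lag a) k * \<epsilon> (s - int k) \<omega>\<bar>)"
        "AE \<omega> in M. \<forall>s. summable (\<lambda>k. \<bar>fps_nth (inv_lag c) k * \<epsilon> (s - int k) \<omega>\<bar>)"
      using conv by (simp_all add: AE_all_countable filter_converges_def)
    then show ?thesis
    proof eventually_elim
      fix \<omega>
      assume "\<forall>s. summable (\<lambda>k. \<bar>fps_nth (inv_lag a) k * \<epsilon> (s - int k) \<omega>\<bar>)"
        "\<forall>s. summable (\<lambda>k. \<bar>fps_nth (inv_lag c) k * \<epsilon> (s - int k) \<omega>\<bar>)"
      then have "summable (\<lambda>k. fps_nth (inv_lag a) k * \<epsilon> (s - int k) \<omega>)"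
          "summable (\<lambda>k. fps_nth (inv_lag c) k * \<epsilon> (s - int k) \<omega>)" for s
        by (auto intro: summable_rabs_cancel)
      then show "xi_process a c \<epsilon> (t + 1) \<omega> =
          F_mat a c *\<^sub>v xi_process a c \<epsilon> t \<omega> + \<epsilon> t \<omega> \<cdot>\<^sub>v B_vec p q"
        unfolding dims[symmetric] by (rule xi_process_Suc)
    qed
  qed
  have dim_F: "dim_row (F_mat a c) = dim_vec a + dim_vec c"
    using F_mat_carrier[of a c] by simp
  show "has_transfer_function_on (F_mat a c) (B_vec p q) (tau a c)
      (- (complex_zeros (hat_poly a) \<union> complex_zeros (hat_poly c)))"
    unfolding has_transfer_function_on_def dim_F
  proof
    fix z assume "z \<in> - (complex_zeros (hat_poly a) \<union> complex_zeros (hat_poly c))"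
    then have z: "z \<notin> complex_zeros (hat_poly a) \<union> complex_zeros (hat_poly c)" by simp
    define n where "n = dim_vec a + dim_vec c"
    define N where "N = z \<cdot>\<^sub>m 1\<^sub>m n - map_mat complex_of_real (F_mat a c)"
    obtain R where R: "R \<in> carrier_mat n n" "R * N = 1\<^sub>m n" "N * R = 1\<^sub>m n"
      using resolvent_exists[OF z] unfolding n_def N_def by blast
    have N: "N \<in> carrier_mat n n"
      using F_mat_carrier[of a c] by (auto simp: N_def n_def)
    have tau: "tau a c z \<in> carrier_vec n"
      by (simp add: tau_def u_star_def n_def)
    have "R *\<^sub>v map_vec complex_of_real (B_vec p q) = R *\<^sub>v (N *\<^sub>v tau a c z)"
      using resolvent_times_tau[OF z] by (simp add: N_def n_def dims)
    also have "\<dots> = tau a c z"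
      using R N tau by (simp flip: assoc_mult_mat_vec)
    finally have "R *\<^sub>v map_vec complex_of_real (B_vec p q) = tau a c z" .
    then show "\<exists>R\<in>carrier_mat (dim_vec a + dim_vec c) (dim_vec a + dim_vec c).
        inverts_mat R (z \<cdot>\<^sub>m 1\<^sub>m (dim_vec a + dim_vec c) - map_mat complex_of_real (F_mat a c))
        \<and> inverts_mat (z \<cdot>\<^sub>m 1\<^sub>m (dim_vec a + dim_vec c) - map_mat complex_of_real (F_mat a c)) R
        \<and> R *\<^sub>v map_vec complex_of_real (B_vec p q) = tau a c z"
      using R N unfolding n_def[symmetric] N_def[symmetric] by (auto simp: inverts_mat_def)
  qed
  show "stable_mat (F_mat a c)"
    unfolding stable_mat_def eigenvalue_def eigenvector_def
    using F_mat_eigenvector assms(5,6) by (auto simp: dim_F) blast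
  show "controllable (F_mat a c) (B_vec p q) \<longleftrightarrow>
      complex_zeros (hat_poly a) \<inter> complex_zeros (hat_poly c) = {}"
    using controllable_if_no_common_zeros[OF ge] no_common_zeros_if_controllable[OF ge]
    by (auto simp: dims)
qed

end
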